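(* Let $N\ge 2$ agents communicate over a fixed, undirected, connected graph; let $\mathcal N_i\neq\emptyset$ be the neighbor set of agent $i$. Fix weights $w_1,w_2,w_3>0$, a sampling period $h>0$, constants $d>0$, $\nu>0$, and for each agent bounds $\dot\delta_{i,\min}<0<\dot\delta_{i,\max}$ and $\ddot\gamma_{i,\max}>0$. Let $\delta^0_{i,1},\dot\delta^0_{i,1}\in\mathbb R$ be initial values with \[ \dot\delta_{i,\min}\le\dot\delta^0_{i,1}\le\dot\delta_{i,\max},\qquad i=1,\dots,N, \] and let $\alpha_i^k$ ($k\ge1$) be real numbers with $|\alpha_i^k|\le d\,e^{-\nu kh}$ for all $i$ and $k\ge1$. Let the sequences be generated by the constrained one-step distributed MPC scheme described in the context, and write $\bm\Delta^0=(\delta^0_{1,1},\dots,\delta^0_{N,1})^T$, $\dot{\bm\Delta}^0=(\dot\delta^0_{1,1},\dots,\dot\delta^0_{N,1})^T$. Then, for all sufficiently small $h>0$, there exist constants $\nu_h>0$ and $d_h>0$ such that, if \[ \max\{\|\bm\Delta^0\|_\infty,\|\dot{\bm\Delta}^0\|_\infty\}<\nu_h\qquad\text{and}\qquad 0<d<d_h, \] then for all $i=1,\dots,N$ and all $k\ge1$, \[ \dot\delta_{i,\min}\le\dot\delta^k_{i,1}\le\dot\delta_{i,\max},\qquad |u^k_{i,0}|\le\ddot\gamma_{i,\max}, \] and there exist $r_h\in(0,1)$, $M_0^h>0$, $\dot M_0^h>0$ such that for all $k\ge1$ and $i,j$: $|\delta^k_{i,0}-\delta^k_{j,0}|\le M_0^h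 r_h^k$ and $|\dot\delta^k_{i,0}|\le\dot M_0^h r_h^k$.
   Context: Constrained distributed MPC scheme with prediction horizon $K=1$. For $k=1,2,\dots$ and each agent $i$, set \[ \delta^k_{i,0}=\delta^{k-1}_{i,1}-\alpha_i^k,\qquad \dot\delta^k_{i,0}=\dot\delta^{k-1}_{i,1}, \] and choose $u^k_{i,0}$ as the minimizer of \[ \frac{w_1}{|\mathcal N_i|}\sum_{j\in\mathcal N_i}\big(\delta^k_{i,1}-\delta^{k-1}_{j,1}\big)^2+w_2\big(\dot\delta^k_{i,1}\big)^2+w_3u^2 \] over $u\in\mathbb R$, where \[ \delta^k_{i,1}=\delta^k_{i,0}+h\dot\delta^k_{i,0}+\tfrac{h^2}{2}u,\qquad \dot\delta^k_{i,1}=\dot\delta^k_{i,0}+hu, \] subject to the constraints \[ \dot\delta_{i,\min}\le\dot\delta^k_{i,\tau}\le\dot\delta_{i,\max}\ (\tau=0,1),\qquad |u|\le\ddot\gamma_{i,\max}. \] The resulting $\delta^k_{i,1},\dot\delta^k_{i,1}$ are then used at the next step. In the application, $\dot\delta_{i,\min}=\dot\gamma_{i,\min}-1$ and $\dot\delta_{i,\max}=\dot\gamma_{i,\max}-1$ are bounds on the virtual-time rate deviation, $\ddot\gamma_{i,\max}$ bounds the virtual-time acceleration, and $\alpha_i^k$ is a path-following correction. *)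

theory Defs
  imports Complex_Main
begin

text \<open>Agents are indexed by natural numbers i < N; the communication graph is given by an
adjacency relation E on {0..<N}.  Sequences are indexed as f k i (time step k, agent i).\<close>

definition nbrs :: "nat \<Rightarrow> (nat \<Rightarrow> nat \<Rightarrow> bool) \<Rightarrow> nat \<Rightarrow> nat set" where
  "nbrs N E i = {j. j < N \<and> E i j}"

definition undirected_connected_graph :: "nat \<Rightarrow> (nat \<Rightarrow> nat \<Rightarrow> bool) \<Rightarrow> bool" where
  "undirected_connected_graph N E \<longleftrightarrow>
     (\<forall>i<N. \<forall>j<N. E i j \<longrightarrow> E j i) \<and> (\<forall>i<N. \<not> E i i) \<and>
     (\<forall>i<N. \<forall>j<N. (\<lambda>a b. a < N \<and> b < N \<and> E a b)\<^sup>*\<^sup>* i j)"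

text \<open>Cost of the one-step MPC problem of agent i at step k, as a function of u.
  prev = previous predicted positions delta^(k-1)_(j,1) of all agents,
  x0 = delta^k_(i,0), v0 = dot delta^k_(i,0).\<close>
definition mpc_cost :: "real \<Rightarrow> real \<Rightarrow> real \<Rightarrow> real \<Rightarrow> nat set \<Rightarrow> (nat \<Rightarrow> real)
    \<Rightarrow> real \<Rightarrow> real \<Rightarrow> real \<Rightarrow> real" where
  "mpc_cost w1 w2 w3 h Nb prev x0 v0 u =
     w1 / real (card Nb) * (\<Sum>j\<in>Nb. (x0 + h * v0 + h\<^sup>2 / 2 * u - prev j)\<^sup>2)
     + w2 * (v0 + h * u)\<^sup>2 + w3 * u\<^sup>2"

definition mpc_feasible :: "real \<Rightarrow> real \<Rightarrow> real \<Rightarrow> real \<Rightarrow> real \<Rightarrow> real set" where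
  "mpc_feasible dmin dmax gmax h v0 =
     {u. dmin \<le> v0 \<and> v0 \<le> dmax \<and> dmin \<le> v0 + h * u \<and> v0 + h * u \<le> dmax \<and> \<bar>u\<bar> \<le> gmax}"

text \<open>The sequences (d0 = delta_(.,0), dd0 = dot delta_(.,0), u = u_(.,0),
  d1 = delta_(.,1), dd1 = dot delta_(.,1)) are generated by the constrained
  one-step distributed MPC scheme from initial values x0, v0 and corrections alpha.\<close>
definition mpc_generated ::
  "nat \<Rightarrow> (nat \<Rightarrow> nat \<Rightarrow> bool) \<Rightarrow> real \<Rightarrow> real \<Rightarrow> real \<Rightarrow> real
   \<Rightarrow> (nat \<Rightarrow> real) \<Rightarrow> (nat \<Rightarrow> real) \<Rightarrow> (nat \<Rightarrow> real)
   \<Rightarrow> (nat \<Rightarrow> nat \<Rightarrow> real) \<Rightarrow> (nat \<Rightarrow> real) \<Rightarrow> (nat \<Rightarrow> real)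
   \<Rightarrow> (nat \<Rightarrow> nat \<Rightarrow> real) \<Rightarrow> (nat \<Rightarrow> nat \<Rightarrow> real) \<Rightarrow> (nat \<Rightarrow> nat \<Rightarrow> real)
   \<Rightarrow> (nat \<Rightarrow> nat \<Rightarrow> real) \<Rightarrow> (nat \<Rightarrow> nat \<Rightarrow> real) \<Rightarrow> bool" where
  "mpc_generated N E w1 w2 w3 h dmin dmax gmax alpha x0 v0 d0 dd0 u d1 dd1 \<longleftrightarrow>
     (\<forall>i<N. d1 0 i = x0 i \<and> dd1 0 i = v0 i) \<and>
     (\<forall>k\<ge>1. \<forall>i<N.
        d0 k i = d1 (k - 1) i - alpha k i \<and>
        dd0 k i = dd1 (k - 1) i \<and>
        u k i \<in> mpc_feasible (dmin i) (dmax i) (gmax i) h (dd0 k i) \<and>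
        (\<forall>v\<in>mpc_feasible (dmin i) (dmax i) (gmax i) h (dd0 k i).
            mpc_cost w1 w2 w3 h (nbrs N E i) (d1 (k - 1)) (d0 k i) (dd0 k i) (u k i)
            \<le> mpc_cost w1 w2 w3 h (nbrs N E i) (d1 (k - 1)) (d0 k i) (dd0 k i) v) \<and>
        d1 k i = d0 k i + h * dd0 k i + h\<^sup>2 / 2 * u k i \<and>
        dd1 k i = dd0 k i + h * u k i)"

end

(* Without the constraints each minimizer is an affine feedback, so the scheme is a linear
   iteration in the positions x and the scaled velocities y = h * v, driven by the corrections.
   With p, q the feedback gains (0 < p < q < 2), the energy (2 - q) |y|^2 + p <grad x, grad x>
   decreases by at least 4 (q - p) |m|^2 per step, where m is the mean of the old and the new y.
   Since two consecutive values of m control the energy (Poincare inequality on the connected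
   graph), the sum of two consecutive energies contracts geometrically, and exponentially
   decaying corrections preserve this. The velocities thus stay of the order of the initial data
   and d; if these are small, the unconstrained trajectory satisfies the constraints at all times
   and, by strict convexity of the cost, is the one produced by the constrained scheme. *)
theory Submission
  imports Defs
begin

section \<open>Elementary inequalities for squares of sums\<close>

text \<open>The free weight \<eta> is what matters later: for small \<eta> the first square is
  barely enlarged, so a contraction survives a perturbation.\<close>

lemma young_square:
  fixes a b \<eta> :: real
  assumes "\<eta> > 0"
  shows "(a + b)\<^sup>2 \<le> (1 + \<eta>) * a\<^sup>2 + (1 + 1 / \<eta>) * b\<^sup>2"
proof -
  have "0 \<le> (\<eta> * a - b)\<^sup>2 / \<eta>" using assms by simp
  also have "\<dots> = \<eta> * a\<^sup>2 - 2 * a * b + b\<^sup>2 / \<eta>"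
    using assms by (simp add: field_simps power2_eq_square)
  finally show ?thesis by (simp add: power2_eq_square algebra_simps)
qed

lemma square_sum3:
  fixes a b c :: real
  shows "(a + b + c)\<^sup>2 \<le> 3 * (a\<^sup>2 + b\<^sup>2 + c\<^sup>2)"
proof -
  have "0 \<le> (a - b)\<^sup>2 + (b - c)\<^sup>2 + (a - c)\<^sup>2" by simp
  then show ?thesis by (simp add: power2_eq_square algebra_simps)
qed

section \<open>Dirichlet forms on a connected graph\<close>

locale comm_graph =
  fixes N :: nat and E :: "nat \<Rightarrow> nat \<Rightarrow> bool"
  assumes graph: "undirected_connected_graph N E"
    and nbrs_nonempty: "i < N \<Longrightarrow> nbrs N E i \<noteq> {}"
begin

abbreviation nb :: "nat \<Rightarrow> nat set" where "nb \<equiv> nbrs N E"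

lemma finite_nb [simp]: "finite (nb i)"
  by (simp add: nbrs_def)

lemma nb_less: "j \<in> nb i \<Longrightarrow> j < N"
  by (simp add: nbrs_def)

lemma card_nb_pos: "i < N \<Longrightarrow> card (nb i) > 0"
  using nbrs_nonempty by (simp add: card_gt_0_iff)

text \<open>Every edge is counted in both orientations, and a summand depending on i alone is
  weighted by the degree of i. With this weighting the operator \<open>lap\<close> is
  symmetric.\<close>

definition arcsum :: "(nat \<Rightarrow> nat \<Rightarrow> real) \<Rightarrow> real" where
  "arcsum f = (\<Sum>i<N. \<Sum>j\<in>nb i. f i j)"

lemma arcsum_add: "arcsum (\<lambda>i j. f i j + g i j) = arcsum f + arcsum g"
  by (simp add: arcsum_def sum.distrib)

lemma arcsum_diff: "arcsum (\<lambda>i j. f i j - g i j) = arcsum f - arcsum g"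
  by (simp add: arcsum_def sum_subtractf)

lemma arcsum_scale: "arcsum (\<lambda>i j. c * f i j) = c * arcsum f"
  by (simp add: arcsum_def sum_distrib_left)

lemma arcsum_mono:
  "(\<And>i j. i < N \<Longrightarrow> j \<in> nb i \<Longrightarrow> f i j \<le> g i j) \<Longrightarrow> arcsum f \<le> arcsum g"
  unfolding arcsum_def by (intro sum_mono) auto

lemma arcsum_cong:
  "(\<And>i j. i < N \<Longrightarrow> j \<in> nb i \<Longrightarrow> f i j = g i j) \<Longrightarrow> arcsum f = arcsum g"
  unfolding arcsum_def by (intro sum.cong) auto

lemma arcsum_nonneg:
  "(\<And>i j. i < N \<Longrightarrow> j \<in> nb i \<Longrightarrow> 0 \<le> f i j) \<Longrightarrow> 0 \<le> arcsum f"
  unfolding arcsum_def by (intro sum_nonneg) auto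

lemma arcsum_swap: "arcsum (\<lambda>i j. f j i) = arcsum f"
proof -
  \<comment> \<open>Neighbor sets become filtered index ranges, the shape in which
    \<open>sum.swap_restrict\<close> exchanges the two sums; symmetry of \<open>E\<close> then
    restores the filter.\<close>
  have "arcsum f = (\<Sum>i<N. \<Sum>j | j \<in> {..<N} \<and> E i j. f i j)" for f
    by (auto simp: arcsum_def nbrs_def)
  note eq = this
  have "arcsum (\<lambda>i j. f j i) = (\<Sum>j<N. \<Sum>i | i \<in> {..<N} \<and> E i j. f j i)"
    unfolding eq by (intro sum.swap_restrict) auto
  also have "\<dots> = arcsum f"
    unfolding eq using graph
    by (intro sum.cong refl) (auto simp: undirected_connected_graph_def)
  finally show ?thesis .
qed

lemma le_arcsum:
  assumes nonneg: "\<And>i j. i < N \<Longrightarrow> j \<in> nb i \<Longrightarrow> 0 \<le> f i j"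
    and "i < N" "j \<in> nb i"
  shows "f i j \<le> arcsum f"
proof -
  have "f i j \<le> (\<Sum>j\<in>nb i. f i j)"
    using assms by (intro member_le_sum) auto
  also have "\<dots> \<le> arcsum f"
    unfolding arcsum_def using assms
    by (intro member_le_sum[where f = "\<lambda>i. \<Sum>j\<in>nb i. f i j"] sum_nonneg) auto
  finally show ?thesis .
qed

section \<open>Weighted norm, Dirichlet form and Laplacian\<close>

definition mass :: "(nat \<Rightarrow> real) \<Rightarrow> real" where
  "mass x = arcsum (\<lambda>i j. (x i)\<^sup>2)"

definition dirichlet :: "(nat \<Rightarrow> real) \<Rightarrow> real" where
  "dirichlet x = arcsum (\<lambda>i j. (x i - x j)\<^sup>2)"

text \<open>The random-walk Laplacian I - D^-1 A. The division of the position cost by the number of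
  neighbors leads to exactly this normalization.\<close>

definition lap :: "(nat \<Rightarrow> real) \<Rightarrow> nat \<Rightarrow> real" where
  "lap x i = x i - (\<Sum>j\<in>nb i. x j) / card (nb i)"

lemma mass_nonneg: "0 \<le> mass x"
  unfolding mass_def by (intro arcsum_nonneg) auto

lemma dirichlet_nonneg: "0 \<le> dirichlet x"
  unfolding dirichlet_def by (intro arcsum_nonneg) auto

lemma square_le_mass: "i < N \<Longrightarrow> (x i)\<^sup>2 \<le> mass x"
  unfolding mass_def using nbrs_nonempty[of i]
  by (force intro: le_arcsum[where f = "\<lambda>i j. (x i)\<^sup>2"])

lemma lap_add: "lap (\<lambda>i. x i + y i) i = lap x i + lap y i"
  by (simp add: lap_def sum.distrib add_divide_distrib)

lemma sum_diff_nb: "i < N \<Longrightarrow> (\<Sum>j\<in>nb i. x i - x j) = card (nb i) * lap x i"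
  using card_nb_pos[of i] by (simp add: lap_def sum_subtractf field_simps)

lemma arcsum_lap: "arcsum (\<lambda>i j. (x i - x j) * g i) = arcsum (\<lambda>i j. lap x i * g i)"
proof -
  have "(\<Sum>j\<in>nb i. (x i - x j) * g i) = (\<Sum>j\<in>nb i. lap x i * g i)" if "i < N" for i
    by (simp only: sum_distrib_right[symmetric] sum_diff_nb[OF that]) simp
  then show ?thesis by (simp add: arcsum_def)
qed

text \<open>Summation by parts: exchanging the endpoints turns the half containing g j into the half
  containing g i.\<close>

lemma arcsum_diff_mult_diff:
  "arcsum (\<lambda>i j. (x i - x j) * (g i - g j)) = 2 * arcsum (\<lambda>i j. lap x i * g i)"
proof -
  have "arcsum (\<lambda>i j. (x i - x j) * (g i - g j))
      = arcsum (\<lambda>i j. (x i - x j) * g i + (x j - x i) * g j)"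
    by (intro arcsum_cong) (simp add: algebra_simps)
  also have "\<dots> = 2 * arcsum (\<lambda>i j. (x i - x j) * g i)"
    using arcsum_swap[of "\<lambda>i j. (x i - x j) * g i"] by (simp add: arcsum_add)
  finally show ?thesis by (simp add: arcsum_lap)
qed

text \<open>Says that no eigenvalue of \<open>lap\<close> exceeds 2. The factor 4 is what turns p <
  q into dissipation in \<open>energy_step_le\<close>.\<close>

lemma dirichlet_le_mass: "dirichlet x \<le> 4 * mass x"
proof -
  have "dirichlet x \<le> arcsum (\<lambda>i j. 2 * (x i)\<^sup>2 + 2 * (x j)\<^sup>2)"
    unfolding dirichlet_def
  proof (intro arcsum_mono)
    fix i j
    have "0 \<le> (x i + x j)\<^sup>2" by simp
    then show "(x i - x j)\<^sup>2 \<le> 2 * (x i)\<^sup>2 + 2 * (x j)\<^sup>2"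
      by (simp add: power2_sum power2_diff)
  qed
  also have "\<dots> = 4 * mass x"
    using arcsum_swap[of "\<lambda>i j. (x i)\<^sup>2"] by (simp add: mass_def arcsum_add arcsum_scale)
  finally show ?thesis .
qed

text \<open>Jensen's inequality at each vertex, since \<open>lap x i\<close> is the mean of x i - x
  j over the neighbors. It is obtained arcwise from 2 t s - s^2 <= t^2.\<close>

lemma mass_lap_le: "mass (lap x) \<le> dirichlet x"
proof -
  have "mass (lap x) = 2 * arcsum (\<lambda>i j. lap x i * lap x i) - mass (lap x)"
    by (simp add: mass_def power2_eq_square)
  also have "\<dots> = arcsum (\<lambda>i j. 2 * ((x i - x j) * lap x i) - (lap x i)\<^sup>2)"
    by (simp add: arcsum_diff arcsum_scale arcsum_lap mass_def)
  also have "\<dots> \<le> dirichlet x"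
    unfolding dirichlet_def
  proof (intro arcsum_mono)
    fix i j
    have "0 \<le> ((x i - x j) - lap x i)\<^sup>2" by simp
    then show "2 * ((x i - x j) * lap x i) - (lap x i)\<^sup>2 \<le> (x i - x j)\<^sup>2"
      by (simp add: power2_eq_square algebra_simps)
  qed
  finally show ?thesis .
qed

section \<open>Poincare inequality\<close>

text \<open>Induction along a path: each new edge contributes one term of the Dirichlet form. The
  constant depends on the path but not on x.\<close>

lemma square_diff_le_dirichlet_aux:
  assumes "(\<lambda>a b. a < N \<and> b < N \<and> E a b)\<^sup>*\<^sup>* i j"
  shows "\<exists>C\<ge>0. \<forall>x. (x i - x j)\<^sup>2 \<le> C * dirichlet x"
  using assms
proof (induction rule: rtranclp_induct)
  case base
  then show ?case by (intro exI[of _ 0]) auto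
next
  case (step j k)
  then obtain C where C: "C \<ge> 0" "\<And>x. (x i - x j)\<^sup>2 \<le> C * dirichlet x" by blast
  have "(x i - x k)\<^sup>2 \<le> (2 * C + 2) * dirichlet x" for x
  proof -
    have "(x j - x k)\<^sup>2 \<le> dirichlet x"
      unfolding dirichlet_def using step(2)
      by (intro le_arcsum[where f = "\<lambda>i j. (x i - x j)\<^sup>2"]) (auto simp: nbrs_def)
    moreover have "(x i - x k)\<^sup>2 \<le> 2 * (x i - x j)\<^sup>2 + 2 * (x j - x k)\<^sup>2"
      using young_square[of 1 "x i - x j" "x j - x k"] by simp
    ultimately show ?thesis using C(2)[of x] by (simp add: algebra_simps)
  qed
  then show ?case using C(1) by (intro exI[of _ "2 * C + 2"]) auto
qed

lemma square_diff_le_dirichlet: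
  obtains C where "C > 0" "\<And>x i j. i < N \<Longrightarrow> j < N \<Longrightarrow> (x i - x j)\<^sup>2 \<le> C * dirichlet x"
proof -
  have "\<exists>C\<ge>0. \<forall>x. (x i - x j)\<^sup>2 \<le> C * dirichlet x" if "i < N" "j < N" for i j
    using square_diff_le_dirichlet_aux graph that
    unfolding undirected_connected_graph_def by blast
  then obtain C where C: "\<And>i j. i < N \<Longrightarrow> j < N \<Longrightarrow> C i j \<ge> 0"
    "\<And>i j x. i < N \<Longrightarrow> j < N \<Longrightarrow> (x i - x j)\<^sup>2 \<le> C i j * dirichlet x"
    by metis
  \<comment> \<open>One constant for all pairs: the sum of the finitely many pairwise constants,
    plus 1 for positivity.\<close>
  define B where "B = 1 + (\<Sum>i<N. \<Sum>j<N. C i j)"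
  have "C i j \<le> B" if "i < N" "j < N" for i j
  proof -
    have "C i j \<le> (\<Sum>j<N. C i j)" using that C by (intro member_le_sum) auto
    also have "\<dots> \<le> (\<Sum>i<N. \<Sum>j<N. C i j)"
      using that C by (intro member_le_sum[where f = "\<lambda>i. \<Sum>j<N. C i j"] sum_nonneg) auto
    finally show ?thesis by (simp add: B_def)
  qed
  then have "(x i - x j)\<^sup>2 \<le> B * dirichlet x" if "i < N" "j < N" for i j x
    using C(2)[OF that, of x] that
    by (meson dirichlet_nonneg mult_right_mono order_trans)
  moreover have "B > 0"
    using C(1) by (auto simp: B_def intro!: add_pos_nonneg sum_nonneg)
  ultimately show ?thesis using that by blast
qed

text \<open>Poincare inequality: as \<open>lap x\<close> has degree-weighted mean zero, the pairing of \<open>lap x\<close>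
  with \<open>x\<close> may be replaced by the one with \<open>x - x 0\<close>, which the Dirichlet form controls.\<close>
lemma dirichlet_le_mass_lap:
  obtains C where "C > 0" "\<And>x. dirichlet x \<le> C * mass (lap x)"
proof -
  obtain B where B: "B > 0" "\<And>x i j. i < N \<Longrightarrow> j < N \<Longrightarrow> (x i - x j)\<^sup>2 \<le> B * dirichlet x"
    using square_diff_le_dirichlet by blast
  define K where "K = 1 + arcsum (\<lambda>i j. 1)"
  have K: "K \<ge> 1" unfolding K_def using arcsum_nonneg[of "\<lambda>i j. 1"] by simp
  \<comment> \<open>With this choice \<eta> B (K - 1) <= 1/2, so the Dirichlet form reappearing on
    the right is absorbed by the left side.\<close>
  define \<eta> where "\<eta> = 1 / (2 * B * K)"
  have \<eta>: "\<eta> > 0" using B K by (simp add: \<eta>_def)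
  have "dirichlet x \<le> (2 / \<eta>) * mass (lap x)" for x
  proof -
    have "arcsum (\<lambda>i j. lap x i * 1) = 0"
      using arcsum_diff_mult_diff[of x "\<lambda>_. 1"] by (simp add: arcsum_def)
    then have "dirichlet x = 2 * arcsum (\<lambda>i j. lap x i * x i) - 2 * x 0 * arcsum (\<lambda>i j. lap x i * 1)"
      using arcsum_diff_mult_diff[of x x] by (simp add: dirichlet_def power2_eq_square)
    also have "\<dots> = arcsum (\<lambda>i j. 2 * (lap x i * x i) - 2 * x 0 * (lap x i * 1))"
      by (simp only: arcsum_diff arcsum_scale)
    also have "\<dots> \<le> arcsum (\<lambda>i j. (1 / \<eta>) * (lap x i)\<^sup>2 + \<eta> * B * dirichlet x * 1)"
    proof (intro arcsum_mono)
      fix i j assume "i < N"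
      have "0 \<le> (lap x i - \<eta> * (x i - x 0))\<^sup>2 / \<eta>" using \<eta> by simp
      also have "\<dots> = (1 / \<eta>) * (lap x i)\<^sup>2 - 2 * (lap x i * (x i - x 0)) + \<eta> * (x i - x 0)\<^sup>2"
        using \<eta> by (simp add: field_simps power2_eq_square)
      also have "\<eta> * (x i - x 0)\<^sup>2 \<le> \<eta> * (B * dirichlet x)"
        using \<eta> B(2)[of i 0 x] \<open>i < N\<close> by (intro mult_left_mono) auto
      finally show "2 * (lap x i * x i) - 2 * x 0 * (lap x i * 1)
          \<le> (1 / \<eta>) * (lap x i)\<^sup>2 + \<eta> * B * dirichlet x * 1"
        by (simp add: algebra_simps)
    qed
    also have "\<dots> = (1 / \<eta>) * mass (lap x) + \<eta> * B * (K - 1) * dirichlet x"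
      by (simp only: arcsum_add arcsum_scale mass_def K_def) (simp add: algebra_simps)
    also have "\<eta> * B * (K - 1) * dirichlet x \<le> 1 / 2 * dirichlet x"
      using B K dirichlet_nonneg[of x] by (intro mult_right_mono) (auto simp: \<eta>_def field_simps)
    finally show ?thesis by (simp add: field_simps)
  qed
  then show ?thesis using that[of "2 / \<eta>"] \<eta> by simp
qed

end

section \<open>A Lyapunov function for the unconstrained iteration\<close>

text \<open>In terms of positions \<open>x\<close> and scaled velocities \<open>y = h * v\<close>, the unconstrained scheme without
  corrections is the trapezoidal step \<open>x \<mapsto> x + mid\<close>, where \<open>mid\<close> is the mean of the old and the
  new \<open>y\<close>.\<close>
locale damped_iteration = comm_graph +
  fixes p q :: real
  assumes p_pos: "0 < p" and p_less_q: "p < q" and q_less_2: "q < 2"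
begin

definition mid :: "(nat \<Rightarrow> real) \<Rightarrow> (nat \<Rightarrow> real) \<Rightarrow> nat \<Rightarrow> real" where
  "mid x y i = y i - (p * lap x i + q * y i) / 2"

definition pos :: "(nat \<Rightarrow> real) \<Rightarrow> (nat \<Rightarrow> real) \<Rightarrow> nat \<Rightarrow> real" where
  "pos x y i = x i + mid x y i"

definition vel :: "(nat \<Rightarrow> real) \<Rightarrow> (nat \<Rightarrow> real) \<Rightarrow> nat \<Rightarrow> real" where
  "vel x y i = y i - (p * lap x i + q * y i)"

text \<open>Kinetic plus potential part; the weight 2 - q is the one for which the mixed terms
  cancel in a step.\<close>

definition energy :: "(nat \<Rightarrow> real) \<Rightarrow> (nat \<Rightarrow> real) \<Rightarrow> real" where
  "energy x y = (2 - q) * mass y + p * dirichlet x"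

definition lyap :: "(nat \<Rightarrow> real) \<Rightarrow> (nat \<Rightarrow> real) \<Rightarrow> real" where
  "lyap x y = energy x y + energy (pos x y) (vel x y)"

lemma energy_nonneg: "0 \<le> energy x y"
  using p_pos q_less_2 by (simp add: energy_def mass_nonneg dirichlet_nonneg)

lemma dirichlet_add:
  "dirichlet (\<lambda>i. x i + g i) = dirichlet x + 4 * arcsum (\<lambda>i j. lap x i * g i) + dirichlet g"
proof -
  have "dirichlet (\<lambda>i. x i + g i)
      = arcsum (\<lambda>i j. (x i - x j)\<^sup>2 + 2 * ((x i - x j) * (g i - g j)) + (g i - g j)\<^sup>2)"
    unfolding dirichlet_def by (intro arcsum_cong) (simp add: power2_eq_square algebra_simps)
  then show ?thesis
    by (simp add: arcsum_add arcsum_scale arcsum_diff_mult_diff dirichlet_def)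
qed

text \<open>Since \<open>vel\<close> = 2 mid - y and (2 - q) y = 2 mid + p lap x, the new kinetic
  part contains the cross term -4 p lap x mid. The expansion of the Dirichlet form at x + mid
  cancels it.\<close>

lemma energy_step:
  "energy (pos x y) (vel x y) = energy x y - 4 * q * mass (mid x y) + p * dirichlet (mid x y)"
proof -
  have "(2 - q) * mass (vel x y)
      = arcsum (\<lambda>i j. (2 - q) * (y i)\<^sup>2 - 4 * p * (lap x i * mid x y i) - 4 * q * (mid x y i)\<^sup>2)"
    unfolding mass_def arcsum_scale[symmetric]
    by (intro arcsum_cong) (simp add: vel_def mid_def power2_eq_square field_simps)
  also have "\<dots> = (2 - q) * mass y - 4 * p * arcsum (\<lambda>i j. lap x i * mid x y i)
      - 4 * q * mass (mid x y)"
    by (simp only: arcsum_diff arcsum_scale mass_def)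
  finally show ?thesis
    unfolding energy_def pos_def dirichlet_add by (simp add: algebra_simps)
qed

lemma energy_step_le:
  "energy (pos x y) (vel x y) \<le> energy x y - 4 * (q - p) * mass (mid x y)"
proof -
  have "p * dirichlet (mid x y) \<le> p * (4 * mass (mid x y))"
    using p_pos dirichlet_le_mass by (intro mult_left_mono) auto
  then show ?thesis unfolding energy_step by (simp add: algebra_simps)
qed

lemma energy_step_mono: "energy (pos x y) (vel x y) \<le> energy x y"
proof -
  have "0 \<le> 4 * (q - p) * mass (mid x y)" using p_less_q mass_nonneg by simp
  then show ?thesis using energy_step_le[of x y] by linarith
qed

text \<open>Eliminating y from two consecutive means leaves \<open>lap x\<close>, which on a
  connected graph is the position up to a common translation.\<close>

lemma mid_step:
  "p * lap x i = (1 - q) * mid x y i - mid (pos x y) (vel x y) i - p / 2 * lap (mid x y) i"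
proof -
  have "lap (pos x y) i = lap x i + lap (mid x y) i"
    using lap_add[of x "mid x y" i] by (simp add: pos_def[abs_def])
  then show ?thesis
    by (simp add: mid_def[of "pos x y"] vel_def mid_def[of x y] field_simps)
qed

text \<open>Quantitative observability: \<open>mid_step\<close> bounds \<open>lap x\<close> by the
  two means, the Poincare inequality passes to the Dirichlet form, and (2 - q) y = 2 mid + p lap x
  recovers the velocity.\<close>

lemma energy_observable:
  obtains C where "C > 0"
    "\<And>x y. energy x y \<le> C * (mass (mid x y) + mass (mid (pos x y) (vel x y)))"
proof -
  obtain B where B: "B > 0" "\<And>x. dirichlet x \<le> B * mass (lap x)"
    using dirichlet_le_mass_lap by blast
  \<comment> \<open>The 3 comes from \<open>square_sum3\<close>; p^2 is (p/2)^2 times the factor 4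
    in the bound of \<open>mass (lap m)\<close> by \<open>mass m\<close>.\<close>
  define K where "K = 3 * ((1 - q)\<^sup>2 + 1 + p\<^sup>2)"
  have K: "K \<ge> 3" by (simp add: K_def)
  have K1: "mass (\<lambda>i. p * lap x i) \<le> K * (mass (mid x y) + mass (mid (pos x y) (vel x y)))"
    for x y
  proof -
    let ?m = "mid x y" and ?n = "mid (pos x y) (vel x y)"
    have "mass (\<lambda>i. p * lap x i) \<le> arcsum (\<lambda>i j. 3 * (1 - q)\<^sup>2 * (?m i)\<^sup>2 + 3 * (?n i)\<^sup>2
        + 3 * (p\<^sup>2 / 4) * (lap ?m i)\<^sup>2)"
      unfolding mass_def
    proof (intro arcsum_mono)
      fix i j
      show "(p * lap x i)\<^sup>2 \<le> 3 * (1 - q)\<^sup>2 * (?m i)\<^sup>2 + 3 * (?n i)\<^sup>2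
        + 3 * (p\<^sup>2 / 4) * (lap ?m i)\<^sup>2"
        using square_sum3[of "(1 - q) * ?m i" "- ?n i" "- (p / 2 * lap ?m i)"]
        unfolding mid_step[of x i y]
        by (simp add: power_mult_distrib power_divide distrib_left mult.assoc)
    qed
    also have "\<dots> = 3 * (1 - q)\<^sup>2 * mass ?m + 3 * mass ?n + 3 * (p\<^sup>2 / 4) * mass (lap ?m)"
      by (simp only: arcsum_add arcsum_scale mass_def)
    also have "3 * (p\<^sup>2 / 4) * mass (lap ?m) \<le> 3 * (p\<^sup>2 / 4) * (4 * mass ?m)"
      using mass_lap_le[of ?m] dirichlet_le_mass[of ?m] by (intro mult_left_mono) auto
    finally have "mass (\<lambda>i. p * lap x i) \<le> 3 * ((1 - q)\<^sup>2 + p\<^sup>2) * mass ?m + 3 * mass ?n"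
      by (simp add: algebra_simps)
    also have "\<dots> \<le> K * mass ?m + K * mass ?n"
      using mass_nonneg by (intro add_mono mult_right_mono) (auto simp: K_def)
    finally show ?thesis by (simp add: algebra_simps)
  qed
  have dir: "p * dirichlet x \<le> B / p * mass (\<lambda>i. p * lap x i)" for x
  proof -
    have "mass (\<lambda>i. p * lap x i) = p\<^sup>2 * mass (lap x)"
      by (simp add: mass_def power_mult_distrib arcsum_scale)
    then show ?thesis using B(2)[of x] p_pos by (simp add: power2_eq_square field_simps)
  qed
  \<comment> \<open>The two squares receive coefficients 8 and 2; both are bounded by 8, and one
    factor 2 - q is divided out.\<close>
  define c where "c = 8 / (2 - q)"
  have c: "c > 0" using q_less_2 by (simp add: c_def)
  have vel: "(2 - q) * mass y \<le> c * mass (mid x y) + c * mass (\<lambda>i. p * lap x i)" for x y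
  proof -
    have "(2 - q) * mass y \<le> arcsum (\<lambda>i j. c * (mid x y i)\<^sup>2 + c * (p * lap x i)\<^sup>2)"
      unfolding mass_def arcsum_scale[symmetric]
    proof (intro arcsum_mono)
      fix i j
      have "(2 - q) * y i = 2 * mid x y i + p * lap x i"
        by (simp add: mid_def field_simps)
      then have "(2 - q)\<^sup>2 * (y i)\<^sup>2 = (2 * mid x y i + p * lap x i)\<^sup>2"
        by (metis power_mult_distrib)
      also have "\<dots> \<le> 8 * (mid x y i)\<^sup>2 + 8 * (p * lap x i)\<^sup>2"
      proof -
        have "(2 * mid x y i + p * lap x i)\<^sup>2 \<le> 8 * (mid x y i)\<^sup>2 + 2 * (p * lap x i)\<^sup>2"
          using young_square[of 1 "2 * mid x y i" "p * lap x i"] by (simp add: power2_eq_square)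
        moreover have "0 \<le> (p * lap x i)\<^sup>2" by simp
        ultimately show ?thesis by linarith
      qed
      finally have "(2 - q) * ((2 - q) * (y i)\<^sup>2) \<le> 8 * ((mid x y i)\<^sup>2 + (p * lap x i)\<^sup>2)"
        by (simp add: power2_eq_square[of "2 - q"] distrib_left mult.assoc)
      then have "(2 - q) * (y i)\<^sup>2 \<le> 8 * ((mid x y i)\<^sup>2 + (p * lap x i)\<^sup>2) / (2 - q)"
        using q_less_2 by (subst pos_le_divide_eq) (simp_all add: mult.commute)
      then show "(2 - q) * (y i)\<^sup>2 \<le> c * (mid x y i)\<^sup>2 + c * (p * lap x i)\<^sup>2"
        by (simp add: c_def distrib_left add_divide_distrib)
    qed
    then show ?thesis by (simp only: arcsum_add arcsum_scale mass_def)
  qed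
  define C where "C = c + (c + B / p) * K"
  have "energy x y \<le> C * (mass (mid x y) + mass (mid (pos x y) (vel x y)))" for x y
  proof -
    let ?S = "mass (mid x y) + mass (mid (pos x y) (vel x y))"
    have "energy x y \<le> c * mass (mid x y) + (c + B / p) * mass (\<lambda>i. p * lap x i)"
      unfolding energy_def using dir[of x] vel[of y x] by (simp add: algebra_simps)
    also have "\<dots> \<le> c * ?S + (c + B / p) * (K * ?S)"
      using c B(1) p_pos K1[of x y] mass_nonneg
      by (intro add_mono mult_left_mono) auto
    finally show ?thesis by (simp add: C_def algebra_simps)
  qed
  moreover have "C > 0" using c B(1) p_pos K by (simp add: C_def add_pos_nonneg)
  ultimately show ?thesis using that by blast
qed

text \<open>The energy itself need not decrease strictly (\<open>mid\<close> can vanish), but two consecutive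
  values of \<open>mid\<close> determine the state up to a common translation.\<close>
lemma lyap_contracts:
  obtains c where "0 < c" "c < 1" "\<And>x y. lyap (pos x y) (vel x y) \<le> (1 - c) * lyap x y"
proof -
  obtain C where C: "C > 0"
    "\<And>x y. energy x y \<le> C * (mass (mid x y) + mass (mid (pos x y) (vel x y)))"
    using energy_observable by blast
  \<comment> \<open>As \<open>lyap\<close> is at most 2 C S, the condition k C <= 2 (q - p) lets the
    dissipation 4 (q - p) S of two steps dominate k \<open>lyap\<close>. The 1/2 keeps k below
    1.\<close>
  define k where "k = min (1 / 2) (2 * (q - p) / C)"
  have k: "0 < k" "k < 1" "k * C \<le> 2 * (q - p)"
    using C p_less_q by (auto simp: k_def min_def field_simps)
  have "lyap (pos x y) (vel x y) \<le> (1 - k) * lyap x y" for x y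
  proof -
    let ?x = "pos x y" and ?y = "vel x y"
    let ?S = "mass (mid x y) + mass (mid ?x ?y)"
    have "lyap ?x ?y \<le> lyap x y - 4 * (q - p) * ?S"
      using energy_step_le[of x y] energy_step_le[of ?x ?y]
      by (simp add: lyap_def algebra_simps)
    moreover have "k * lyap x y \<le> k * (2 * (C * ?S))"
      using energy_step_mono[of x y] C(2)[of x y] k(1)
      by (intro mult_left_mono) (auto simp: lyap_def)
    moreover have "k * (2 * (C * ?S)) \<le> 4 * (q - p) * ?S"
      using mult_right_mono[OF k(3), of "2 * ?S"] mass_nonneg[of "mid x y"] mass_nonneg[of "mid ?x ?y"]
      by (simp add: algebra_simps)
    ultimately show ?thesis by (simp add: algebra_simps)
  qed
  then show ?thesis using that k by blast
qed

section \<open>Decay under exponentially decaying perturbations\<close>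

lemma energy_add_le:
  assumes "\<eta> > 0"
  shows "energy (\<lambda>i. x i + a i) (\<lambda>i. y i + b i) \<le> (1 + \<eta>) * energy x y + (1 + 1 / \<eta>) * energy a b"
proof -
  have "mass (\<lambda>i. y i + b i) \<le> arcsum (\<lambda>i j. (1 + \<eta>) * (y i)\<^sup>2 + (1 + 1 / \<eta>) * (b i)\<^sup>2)"
    unfolding mass_def by (intro arcsum_mono young_square assms)
  then have m: "mass (\<lambda>i. y i + b i) \<le> (1 + \<eta>) * mass y + (1 + 1 / \<eta>) * mass b"
    by (simp only: arcsum_add arcsum_scale mass_def)
  have "dirichlet (\<lambda>i. x i + a i)
      \<le> arcsum (\<lambda>i j. (1 + \<eta>) * (x i - x j)\<^sup>2 + (1 + 1 / \<eta>) * (a i - a j)\<^sup>2)"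
    unfolding dirichlet_def
  proof (intro arcsum_mono)
    fix i j
    show "(x i + a i - (x j + a j))\<^sup>2 \<le> (1 + \<eta>) * (x i - x j)\<^sup>2 + (1 + 1 / \<eta>) * (a i - a j)\<^sup>2"
      using young_square[OF assms, of "x i - x j" "a i - a j"] by (simp add: algebra_simps)
  qed
  then have d: "dirichlet (\<lambda>i. x i + a i) \<le> (1 + \<eta>) * dirichlet x + (1 + 1 / \<eta>) * dirichlet a"
    by (simp only: arcsum_add arcsum_scale dirichlet_def)
  have "energy (\<lambda>i. x i + a i) (\<lambda>i. y i + b i)
      \<le> (2 - q) * ((1 + \<eta>) * mass y + (1 + 1 / \<eta>) * mass b)
        + p * ((1 + \<eta>) * dirichlet x + (1 + 1 / \<eta>) * dirichlet a)"
    unfolding energy_def using p_pos q_less_2 m d by (intro add_mono mult_left_mono) auto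
  then show ?thesis by (simp add: energy_def algebra_simps diff_divide_distrib)
qed

text \<open>\<open>pos\<close> and \<open>vel\<close> are linear, so the energy after the step
  splits in the same way as the energy before it.\<close>

lemma lyap_add_le:
  assumes "\<eta> > 0"
  shows "lyap (\<lambda>i. x i + a i) (\<lambda>i. y i + b i) \<le> (1 + \<eta>) * lyap x y + (1 + 1 / \<eta>) * lyap a b"
proof -
  have "pos (\<lambda>i. x i + a i) (\<lambda>i. y i + b i) = (\<lambda>i. pos x y i + pos a b i)"
    "vel (\<lambda>i. x i + a i) (\<lambda>i. y i + b i) = (\<lambda>i. vel x y i + vel a b i)"
    by (auto simp: pos_def vel_def mid_def lap_add algebra_simps add_divide_distrib)
  then show ?thesis
    using energy_add_le[OF assms, of x a y b]
      energy_add_le[OF assms, of "pos x y" "pos a b" "vel x y" "vel a b"]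
    by (simp add: lyap_def algebra_simps)
qed

lemma lyap_le_sup_norm:
  obtains C where "C > 0"
    "\<And>x y b. b \<ge> 0 \<Longrightarrow> (\<And>i. i < N \<Longrightarrow> \<bar>x i\<bar> \<le> b) \<Longrightarrow> (\<And>i. i < N \<Longrightarrow> \<bar>y i\<bar> \<le> b) \<Longrightarrow> lyap x y \<le> C * b\<^sup>2"
proof -
  define K where "K = 1 + arcsum (\<lambda>i j. 1)"
  have K: "K \<ge> 1" unfolding K_def using arcsum_nonneg[of "\<lambda>i j. 1"] by simp
  define C where "C = 2 * ((2 - q) + 4 * p) * K"
  have "lyap x y \<le> C * b\<^sup>2"
    if b: "b \<ge> 0" and x: "\<And>i. i < N \<Longrightarrow> \<bar>x i\<bar> \<le> b" and y: "\<And>i. i < N \<Longrightarrow> \<bar>y i\<bar> \<le> b" for x y b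
  proof -
    have bound: "mass z \<le> K * b\<^sup>2" if "\<And>i. i < N \<Longrightarrow> \<bar>z i\<bar> \<le> b" for z
    proof -
      have "mass z \<le> arcsum (\<lambda>i j. b\<^sup>2 * 1)"
        unfolding mass_def using that b by (intro arcsum_mono) (simp add: power2_le_iff_abs_le)
      also have "\<dots> = (K - 1) * b\<^sup>2"
        by (simp only: arcsum_scale K_def) simp
      also have "\<dots> \<le> K * b\<^sup>2" by (intro mult_right_mono) auto
      finally show ?thesis .
    qed
    have "lyap x y \<le> 2 * energy x y"
      using energy_step_mono[of x y] by (simp add: lyap_def)
    also have "energy x y \<le> (2 - q) * (K * b\<^sup>2) + p * (4 * (K * b\<^sup>2))"
      unfolding energy_def
    proof (intro add_mono mult_left_mono)
      show "mass y \<le> K * b\<^sup>2" using y by (rule bound)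
      show "dirichlet x \<le> 4 * (K * b\<^sup>2)"
        using bound[of x, OF x] dirichlet_le_mass[of x] by (meson mult_left_mono order_trans zero_le_numeral)
    qed (use p_pos q_less_2 in auto)
    finally show ?thesis by (simp add: C_def algebra_simps)
  qed
  moreover have "C > 0" using K p_pos q_less_2 by (simp add: C_def)
  ultimately show ?thesis using that by blast
qed

text \<open>Positions appear only through differences, because \<open>lyap\<close> is invariant
  under a common translation of x.\<close>

lemma lyap_dominates:
  obtains K where "K > 0"
    "\<And>x y i j. i < N \<Longrightarrow> j < N \<Longrightarrow> (x i - x j)\<^sup>2 \<le> K * lyap x y"
    "\<And>x y i. i < N \<Longrightarrow> (y i)\<^sup>2 \<le> K * lyap x y"
proof -
  obtain B where B: "B > 0" "\<And>x i j. i < N \<Longrightarrow> j < N \<Longrightarrow> (x i - x j)\<^sup>2 \<le> B * dirichlet x"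
    using square_diff_le_dirichlet by blast
  define K where "K = B / p + 1 / (2 - q)"
  have K: "K > 0" "B / p \<le> K" "1 / (2 - q) \<le> K"
    using B(1) p_pos q_less_2 by (auto simp: K_def add_pos_pos)
  have lyap: "0 \<le> lyap x y" "p * dirichlet x \<le> lyap x y" "(2 - q) * mass y \<le> lyap x y" for x y
    using energy_nonneg[of "pos x y" "vel x y"] p_pos q_less_2 mass_nonneg[of y] dirichlet_nonneg[of x]
    by (auto simp: lyap_def energy_def intro: add_nonneg_nonneg add_increasing add_increasing2)
  have "(x i - x j)\<^sup>2 \<le> K * lyap x y" if "i < N" "j < N" for x y i j
  proof -
    have "(x i - x j)\<^sup>2 \<le> B / p * (p * dirichlet x)"
      using B(2)[OF that, of x] p_pos by simp
    also have "\<dots> \<le> B / p * lyap x y"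
      using B(1) p_pos lyap by (intro mult_left_mono) auto
    also have "\<dots> \<le> K * lyap x y"
      using K lyap by (intro mult_right_mono) auto
    finally show ?thesis .
  qed
  moreover have "(y i)\<^sup>2 \<le> K * lyap x y" if "i < N" for x y i
  proof -
    have "(y i)\<^sup>2 \<le> 1 / (2 - q) * ((2 - q) * mass y)"
      using square_le_mass[OF that, of y] q_less_2 by simp
    also have "\<dots> \<le> 1 / (2 - q) * lyap x y"
      using q_less_2 lyap by (intro mult_left_mono) auto
    also have "\<dots> \<le> K * lyap x y"
      using K lyap by (intro mult_right_mono) auto
    finally show ?thesis .
  qed
  ultimately show ?thesis using that K by blast
qed

text \<open>Contraction by 1 - c and Young's inequality with weight c combine to the factor (1 +
  c)(1 - c) = 1 - c^2, plus a forcing of order \<sigma>^(2k). C and r are fixed before the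
  trajectory and the bound is linear in b + \<beta>, which later permits smallness
  thresholds.\<close>

lemma perturbed_decay:
  assumes \<sigma>: "0 < \<sigma>" "\<sigma> < 1"
  obtains C r where "C > 0" "\<sigma> \<le> r" "r < 1"
    "\<And>x y a g b \<beta> k i j.
      \<lbrakk>\<And>k. x (Suc k) = (\<lambda>i. pos (x k) (y k) i + a k i);
       \<And>k. y (Suc k) = (\<lambda>i. vel (x k) (y k) i + g k i);
       b \<ge> 0; \<beta> \<ge> 0;
       \<And>i. i < N \<Longrightarrow> \<bar>x 0 i\<bar> \<le> b; \<And>i. i < N \<Longrightarrow> \<bar>y 0 i\<bar> \<le> b;
       \<And>k i. i < N \<Longrightarrow> \<bar>a k i\<bar> \<le> \<beta> * \<sigma> ^ k; \<And>k i. i < N \<Longrightarrow> \<bar>g k i\<bar> \<le> \<beta> * \<sigma> ^ k;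
       i < N; j < N\<rbrakk>
      \<Longrightarrow> \<bar>x k i - x k j\<bar> \<le> C * (b + \<beta>) * r ^ k \<and> \<bar>y k i\<bar> \<le> C * (b + \<beta>) * r ^ k"
proof -
  obtain c where c: "0 < c" "c < 1"
    "\<And>x y. lyap (pos x y) (vel x y) \<le> (1 - c) * lyap x y"
    using lyap_contracts by blast
  obtain L where L: "L > 0"
    "\<And>x y b. b \<ge> 0 \<Longrightarrow> (\<And>i. i < N \<Longrightarrow> \<bar>x i\<bar> \<le> b) \<Longrightarrow> (\<And>i. i < N \<Longrightarrow> \<bar>y i\<bar> \<le> b) \<Longrightarrow> lyap x y \<le> L * b\<^sup>2"
    using lyap_le_sup_norm by blast
  obtain K where K: "K > 0"
    "\<And>x y i j. i < N \<Longrightarrow> j < N \<Longrightarrow> (x i - x j)\<^sup>2 \<le> K * lyap x y"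
    "\<And>x y i. i < N \<Longrightarrow> (y i)\<^sup>2 \<le> K * lyap x y"
    using lyap_dominates by blast
  define \<rho> where "\<rho> = 1 - c\<^sup>2"
  have \<rho>: "0 < \<rho>" "\<rho> < 1" using c by (auto simp: \<rho>_def power_less_one_iff)
  have \<sigma>2: "0 < \<sigma>\<^sup>2" "\<sigma>\<^sup>2 < 1" using \<sigma> by (auto simp: power_less_one_iff)
  \<comment> \<open>Strictly between \<rho> and 1 and not below the forcing rate \<sigma>^2; the
    margin R - \<rho> absorbs the forcing.\<close>
  define R where "R = (1 + max \<rho> (\<sigma>\<^sup>2)) / 2"
  have R: "\<rho> < R" "\<sigma>\<^sup>2 \<le> R" "0 < R" "R < 1"
    using \<rho> \<sigma>2 by (auto simp: R_def)
  define G where "G = (1 + 1 / c) * L"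
  have G: "G > 0" using c L by (simp add: G_def add_pos_pos)
  \<comment> \<open>L covers the initial state; the second summand makes (R - \<rho>) A at least G,
    as the induction step requires.\<close>
  define A where "A = L + G / (R - \<rho>)"
  have A: "A > 0" using L(1) G R by (simp add: A_def add_pos_pos)
  \<comment> \<open>Square roots, since \<open>lyap\<close> is quadratic in the state.\<close>
  define C where "C = sqrt (K * A)"
  have C: "C > 0" "C\<^sup>2 = K * A" using K(1) A by (simp_all add: C_def)
  define r where "r = sqrt R"
  have r: "0 < r" "r\<^sup>2 = R" using R by (simp_all add: r_def)
  have "\<bar>x k i - x k j\<bar> \<le> C * (b + \<beta>) * r ^ k \<and> \<bar>y k i\<bar> \<le> C * (b + \<beta>) * r ^ k"
    if x: "\<And>k. x (Suc k) = (\<lambda>i. pos (x k) (y k) i + a k i)"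
      and y: "\<And>k. y (Suc k) = (\<lambda>i. vel (x k) (y k) i + g k i)"
      and b: "b \<ge> 0" and \<beta>: "\<beta> \<ge> 0"
      and x0: "\<And>i. i < N \<Longrightarrow> \<bar>x 0 i\<bar> \<le> b" and y0: "\<And>i. i < N \<Longrightarrow> \<bar>y 0 i\<bar> \<le> b"
      and a: "\<And>k i. i < N \<Longrightarrow> \<bar>a k i\<bar> \<le> \<beta> * \<sigma> ^ k"
      and g: "\<And>k i. i < N \<Longrightarrow> \<bar>g k i\<bar> \<le> \<beta> * \<sigma> ^ k"
      and ij: "i < N" "j < N"
    for x y a g b \<beta> k i j
  proof -
    define M where "M = A * (b + \<beta>)\<^sup>2"
    have b2: "b\<^sup>2 \<le> (b + \<beta>)\<^sup>2" "\<beta>\<^sup>2 \<le> (b + \<beta>)\<^sup>2"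
      using b \<beta> by (auto intro!: power_mono)
    have step: "lyap (x (Suc k)) (y (Suc k)) \<le> \<rho> * lyap (x k) (y k) + G * \<beta>\<^sup>2 * (\<sigma>\<^sup>2) ^ k" for k
    proof -
      have "lyap (x (Suc k)) (y (Suc k)) \<le> (1 + c) * lyap (pos (x k) (y k)) (vel (x k) (y k))
          + (1 + 1 / c) * lyap (a k) (g k)"
        unfolding x y by (rule lyap_add_le[OF c(1)])
      also have "\<dots> \<le> (1 + c) * ((1 - c) * lyap (x k) (y k))
          + (1 + 1 / c) * (L * (\<beta> * \<sigma> ^ k)\<^sup>2)"
        using c \<beta> \<sigma> a g by (intro add_mono mult_left_mono L(2)) auto
      also have "\<dots> = \<rho> * lyap (x k) (y k) + G * \<beta>\<^sup>2 * (\<sigma>\<^sup>2) ^ k"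
        by (simp add: \<rho>_def G_def power_mult_distrib power2_eq_square algebra_simps)
      finally show ?thesis .
    qed
    have "lyap (x k) (y k) \<le> M * R ^ k" for k
    proof (induction k)
      case 0
      have "lyap (x 0) (y 0) \<le> L * b\<^sup>2" by (intro L(2) b x0 y0)
      also have "\<dots> \<le> A * (b + \<beta>)\<^sup>2"
        using L(1) G R b2 by (intro mult_mono) (auto simp: A_def)
      finally show ?case by (simp add: M_def)
    next
      case (Suc k)
      have "G * \<beta>\<^sup>2 \<le> G * (b + \<beta>)\<^sup>2" using G b2 by simp
      also have "\<dots> = (R - \<rho>) * (G / (R - \<rho>)) * (b + \<beta>)\<^sup>2" using R by simp
      also have "\<dots> \<le> (R - \<rho>) * A * (b + \<beta>)\<^sup>2"
        using R L(1) by (intro mult_right_mono mult_left_mono) (auto simp: A_def)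
      finally have GM: "G * \<beta>\<^sup>2 \<le> (R - \<rho>) * M" by (simp add: M_def)
      have "lyap (x (Suc k)) (y (Suc k)) \<le> \<rho> * lyap (x k) (y k) + G * \<beta>\<^sup>2 * (\<sigma>\<^sup>2) ^ k"
        by (rule step)
      also have "\<dots> \<le> \<rho> * (M * R ^ k) + (R - \<rho>) * M * R ^ k"
        using \<rho> G R \<sigma>2 A
        by (intro add_mono mult_left_mono mult_mono Suc GM power_mono) (auto simp: M_def)
      also have "\<dots> = M * R ^ Suc k" by (simp add: algebra_simps)
      finally show ?case .
    qed
    then have "K * lyap (x k) (y k) \<le> K * (M * R ^ k)" for k
      using K(1) by (intro mult_left_mono) auto
    also have "K * (M * R ^ k) = (C * (b + \<beta>) * r ^ k)\<^sup>2" for k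
      by (simp add: M_def power_mult_distrib C(2) flip: r(2) power_mult)
        (simp add: mult.commute)
    finally have main: "K * lyap (x k) (y k) \<le> (C * (b + \<beta>) * r ^ k)\<^sup>2" .
    have nonneg: "0 \<le> C * (b + \<beta>) * r ^ k" using C(1) b \<beta> r(1) by simp
    show ?thesis
      using K(2)[OF ij, of "x k" "y k"] K(3)[OF ij(1), of "y k" "x k"] main nonneg
      by (meson order_trans power2_le_iff_abs_le)
  qed
  note decay = this
  have "\<sigma> \<le> r" "r < 1"
    using R \<sigma> by (auto simp: r_def real_le_rsqrt)
  then show ?thesis by (rule that[OF C(1)]) (fact decay)
qed

end

section \<open>The unconstrained minimizer and its trajectory\<close>

text \<open>The scheme determines its sequences only for agents below N, so equality of predictions
  is available only on neighbor sets.\<close>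

lemma mpc_cost_cong:
  "(\<And>j. j \<in> Nb \<Longrightarrow> prev j = prev' j) \<Longrightarrow>
    mpc_cost w1 w2 w3 h Nb prev x0 v0 u = mpc_cost w1 w2 w3 h Nb prev' x0 v0 u"
  unfolding mpc_cost_def by (simp cong: sum.cong)

locale mpc_scheme = comm_graph +
  fixes w1 w2 w3 h :: real
  assumes w1: "w1 > 0" and w2: "w2 > 0" and w3: "w3 > 0" and h: "h > 0"
begin

text \<open>Leading coefficient of the cost as a quadratic polynomial in u.\<close>

definition curv :: real where "curv = w1 * h ^ 4 / 4 + w2 * h\<^sup>2 + w3"

text \<open>\<open>stiff\<close> and \<open>damp\<close> are the feedback gains p and q: without
  correction the minimizer satisfies h^2 u = - stiff lap x - damp h v.\<close>

definition stiff :: real where "stiff = w1 * h ^ 4 / 2 / curv"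

definition damp :: real where "damp = (w1 * h ^ 4 / 2 + w2 * h\<^sup>2) / curv"

lemma curv_pos: "curv > 0"
  using w1 w2 w3 h by (simp add: curv_def add_pos_pos)

text \<open>Valid for every h > 0: w2 separates the two gains, and 2 curv exceeds the numerator of
  \<open>damp\<close> by w2 h^2 + 2 w3.\<close>

sublocale damped_iteration N E stiff damp
proof
  show "0 < stiff" using w1 h curv_pos by (simp add: stiff_def)
  show "stiff < damp"
    unfolding stiff_def damp_def using w2 h curv_pos by (intro divide_strict_right_mono) auto
  have "w1 * h ^ 4 / 2 + w2 * h\<^sup>2 < 2 * curv"
    using w1 w2 w3 h by (simp add: curv_def algebra_simps add_pos_pos)
  then show "damp < 2" using curv_pos by (simp add: damp_def divide_less_eq)
qed

definition opt :: "(nat \<Rightarrow> real) \<Rightarrow> (nat \<Rightarrow> real) \<Rightarrow> (nat \<Rightarrow> real) \<Rightarrow> nat \<Rightarrow> real" where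
  "opt x v \<alpha> i = (stiff * (\<alpha> i - lap x i) - damp * (h * v i)) / h\<^sup>2"

text \<open>Completing the square. The identity yields both minimality of \<open>opt\<close> and, as
  \<open>curv\<close> is positive, its uniqueness.\<close>

lemma cost_eq_opt:
  assumes "i < N"
  shows "mpc_cost w1 w2 w3 h (nb i) x (x i - \<alpha> i) (v i) u
    = mpc_cost w1 w2 w3 h (nb i) x (x i - \<alpha> i) (v i) (opt x v \<alpha> i) + curv * (u - opt x v \<alpha> i)\<^sup>2"
proof -
  define n where "n = real (card (nb i))"
  have n: "n > 0" using card_nb_pos[OF assms] by (simp add: n_def)
  \<comment> \<open>The cost sees the neighbors only through the mean P of their positions and the
    mean Q of the squares.\<close>
  define P where "P = x i - lap x i"
  define Q where "Q = (\<Sum>j\<in>nb i. (x j)\<^sup>2) / n"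
  have P: "(\<Sum>j\<in>nb i. x j) = n * P" using n by (simp add: P_def lap_def n_def)
  have Q: "(\<Sum>j\<in>nb i. (x j)\<^sup>2) = n * Q" using n by (simp add: Q_def)
  have "(\<Sum>j\<in>nb i. (z - x j)\<^sup>2) = n * (z\<^sup>2 - 2 * z * P + Q)" for z
  proof -
    have "(\<Sum>j\<in>nb i. (z - x j)\<^sup>2) = (\<Sum>j\<in>nb i. z\<^sup>2 - (2 * z) * x j + (x j)\<^sup>2)"
      by (simp add: power2_diff algebra_simps)
    also have "\<dots> = n * z\<^sup>2 - (2 * z) * (\<Sum>j\<in>nb i. x j) + (\<Sum>j\<in>nb i. (x j)\<^sup>2)"
      by (simp add: sum.distrib sum_subtractf sum_distrib_left n_def)
    finally show ?thesis by (simp only: P Q) (simp add: algebra_simps)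
  qed
  then have cost: "mpc_cost w1 w2 w3 h (nb i) x z y u
      = w1 * ((z + h * y + h\<^sup>2 / 2 * u)\<^sup>2 - 2 * (z + h * y + h\<^sup>2 / 2 * u) * P + Q)
        + w2 * (y + h * u)\<^sup>2 + w3 * u\<^sup>2" for z y u
    using n by (simp add: mpc_cost_def flip: n_def)
  define ob where "ob = opt x v \<alpha> i"
  have "curv * ob = curv * stiff * (\<alpha> i - lap x i) / h\<^sup>2 - curv * damp * (h * v i) / h\<^sup>2"
    using h by (simp add: ob_def opt_def field_simps)
  also have "\<dots> = w1 * h\<^sup>2 / 2 * (\<alpha> i - lap x i) - (w1 * h ^ 3 / 2 + w2 * h) * v i"
    using h curv_pos by (simp add: stiff_def damp_def field_simps eval_nat_numeral)
  \<comment> \<open>Half the derivative of the cost vanishes at \<open>ob\<close>.\<close>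
  finally have crit: "curv * ob + w1 * h\<^sup>2 / 2 * (x i - \<alpha> i + h * v i - P) + w2 * h * v i = 0"
    by (simp add: P_def field_simps eval_nat_numeral)
  have "mpc_cost w1 w2 w3 h (nb i) x (x i - \<alpha> i) (v i) u
      - mpc_cost w1 w2 w3 h (nb i) x (x i - \<alpha> i) (v i) ob - curv * (u - ob)\<^sup>2
    = 2 * (u - ob) * (curv * ob + w1 * h\<^sup>2 / 2 * (x i - \<alpha> i + h * v i - P) + w2 * h * v i)"
    unfolding cost curv_def by (simp add: field_simps eval_nat_numeral)
  then show ?thesis unfolding crit by (simp add: ob_def)
qed

section \<open>The unconstrained trajectory and its agreement with the constrained scheme\<close>

context
  fixes x0 v0 :: "nat \<Rightarrow> real" and \<alpha> :: "nat \<Rightarrow> nat \<Rightarrow> real"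
begin

primrec lin :: "nat \<Rightarrow> (nat \<Rightarrow> real) \<times> (nat \<Rightarrow> real)" where
  "lin 0 = (x0, v0)"
| "lin (Suc k) = (let (x, v) = lin k; u = opt x v (\<alpha> (Suc k)) in
    (\<lambda>i. x i - \<alpha> (Suc k) i + h * v i + h\<^sup>2 / 2 * u i, \<lambda>i. v i + h * u i))"

definition linx :: "nat \<Rightarrow> nat \<Rightarrow> real" where "linx k = fst (lin k)"

definition linv :: "nat \<Rightarrow> nat \<Rightarrow> real" where "linv k = snd (lin k)"

definition linu :: "nat \<Rightarrow> nat \<Rightarrow> real" where
  "linu k = opt (linx (k - 1)) (linv (k - 1)) (\<alpha> k)"

lemma lin_0: "linx 0 = x0" "linv 0 = v0"
  by (simp_all add: linx_def linv_def)

lemma linx_Suc: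
  "linx (Suc k) i = linx k i - \<alpha> (Suc k) i + h * linv k i + h\<^sup>2 / 2 * linu (Suc k) i"
  by (simp add: linx_def linv_def linu_def Let_def case_prod_beta)

lemma linv_Suc: "linv (Suc k) i = linv k i + h * linu (Suc k) i"
  by (simp add: linx_def linv_def linu_def Let_def case_prod_beta)

lemma linu_Suc: "linu (Suc k) = opt (linx k) (linv k) (\<alpha> (Suc k))"
  by (simp add: linu_def)

text \<open>The correction acts twice: it shifts the position by -\<alpha>, and through the feedback
  by h^2/2 times stiff \<alpha> / h^2.\<close>

lemma linx_Suc_pos:
  "linx (Suc k) = (\<lambda>i. pos (linx k) (\<lambda>i. h * linv k i) i + (stiff / 2 - 1) * \<alpha> (Suc k) i)"
  using h by (intro ext) (simp add: linx_Suc linu_Suc opt_def pos_def mid_def field_simps)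

lemma linv_Suc_vel:
  "(\<lambda>i. h * linv (Suc k) i) = (\<lambda>i. vel (linx k) (\<lambda>i. h * linv k i) i + stiff * \<alpha> (Suc k) i)"
  using h by (intro ext) (simp add: linv_Suc linu_Suc opt_def vel_def field_simps power2_eq_square)

text \<open>A minimizer over all reals that is feasible also minimizes over the feasible
  set.\<close>

lemma lin_generated:
  assumes "\<And>k i. i < N \<Longrightarrow> linu (Suc k) i \<in> mpc_feasible (dmin i) (dmax i) (gmax i) h (linv k i)"
  shows "mpc_generated N E w1 w2 w3 h dmin dmax gmax \<alpha> x0 v0
    (\<lambda>k i. linx (k - 1) i - \<alpha> k i) (\<lambda>k. linv (k - 1)) linu linx linv"
proof -
  have "mpc_cost w1 w2 w3 h (nb i) (linx k) (linx k i - \<alpha> (Suc k) i) (linv k i) (linu (Suc k) i)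
      \<le> mpc_cost w1 w2 w3 h (nb i) (linx k) (linx k i - \<alpha> (Suc k) i) (linv k i) u"
    if "i < N" for k i u
    using cost_eq_opt[OF that, of "linx k" "\<alpha> (Suc k)" "linv k" u] curv_pos by (simp add: linu_Suc)
  then have "\<And>k. k \<ge> 1 \<Longrightarrow> \<forall>i<N.
      linu k i \<in> mpc_feasible (dmin i) (dmax i) (gmax i) h (linv (k - 1) i) \<and>
      (\<forall>v\<in>mpc_feasible (dmin i) (dmax i) (gmax i) h (linv (k - 1) i).
         mpc_cost w1 w2 w3 h (nb i) (linx (k - 1)) (linx (k - 1) i - \<alpha> k i) (linv (k - 1) i) (linu k i)
         \<le> mpc_cost w1 w2 w3 h (nb i) (linx (k - 1)) (linx (k - 1) i - \<alpha> k i) (linv (k - 1) i) v) \<and>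
      linx k i = linx (k - 1) i - \<alpha> k i + h * linv (k - 1) i + h\<^sup>2 / 2 * linu k i \<and>
      linv k i = linv (k - 1) i + h * linu k i"
    using assms linx_Suc linv_Suc by (metis Suc_diff_1 less_eq_Suc_le One_nat_def)
  then show ?thesis by (simp add: mpc_generated_def lin_0)
qed

text \<open>If the global minimizer is feasible, the constrained one costs no more, so the square in
  \<open>cost_eq_opt\<close> vanishes. The induction treats all agents at once, because each cost
  involves the neighbors' predictions.\<close>

lemma generated_eq_lin:
  assumes feas: "\<And>k i. i < N \<Longrightarrow> linu (Suc k) i \<in> mpc_feasible (dmin i) (dmax i) (gmax i) h (linv k i)"
    and gen: "mpc_generated N E w1 w2 w3 h dmin dmax gmax \<alpha> x0 v0 d0 dd0 u d1 dd1"
    and "i < N"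
  shows "d1 k i = linx k i \<and> dd1 k i = linv k i"
  using \<open>i < N\<close>
proof (induction k arbitrary: i)
  case 0
  then show ?case using gen by (simp add: mpc_generated_def lin_0)
next
  case (Suc k)
  let ?F = "mpc_feasible (dmin i) (dmax i) (gmax i) h"
  let ?J = "\<lambda>p. mpc_cost w1 w2 w3 h (nb i) p (linx k i - \<alpha> (Suc k) i) (linv k i)"
  have prev: "d1 k i = linx k i" "dd1 k i = linv k i" "\<And>j. j \<in> nb i \<Longrightarrow> d1 k j = linx k j"
    using Suc nb_less by blast+
  have gen': "d0 (Suc k) i = d1 k i - \<alpha> (Suc k) i" "dd0 (Suc k) i = dd1 k i"
    "\<forall>v\<in>?F (dd0 (Suc k) i). mpc_cost w1 w2 w3 h (nb i) (d1 k) (d0 (Suc k) i) (dd0 (Suc k) i) (u (Suc k) i)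
      \<le> mpc_cost w1 w2 w3 h (nb i) (d1 k) (d0 (Suc k) i) (dd0 (Suc k) i) v"
    "d1 (Suc k) i = d0 (Suc k) i + h * dd0 (Suc k) i + h\<^sup>2 / 2 * u (Suc k) i"
    "dd1 (Suc k) i = dd0 (Suc k) i + h * u (Suc k) i"
    using gen[unfolded mpc_generated_def, THEN conjunct2, THEN spec, of "Suc k", unfolded diff_Suc_1]
      \<open>i < N\<close> le_add1[of 1 k, unfolded plus_1_eq_Suc] by blast+
  have "?J (d1 k) (u (Suc k) i) \<le> ?J (d1 k) (linu (Suc k) i)"
    using bspec[OF gen'(3), of "linu (Suc k) i"] feas[OF \<open>i < N\<close>, of k]
    by (simp add: gen'(1,2) prev(1,2))
  then have "?J (linx k) (u (Suc k) i) \<le> ?J (linx k) (linu (Suc k) i)"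
    using prev(3) mpc_cost_cong[of "nb i" "d1 k" "linx k"] by simp
  then have "curv * (u (Suc k) i - linu (Suc k) i)\<^sup>2 \<le> 0"
    using cost_eq_opt[OF \<open>i < N\<close>, of "linx k" "\<alpha> (Suc k)" "linv k" "u (Suc k) i"]
    by (simp add: linu_Suc)
  then have "u (Suc k) i = linu (Suc k) i"
    using curv_pos by (simp add: mult_le_0_iff)
  then show ?case
    by (simp add: gen' prev(1,2) linx_Suc linv_Suc)
qed

end

lemma lin_decay:
  assumes \<sigma>: "0 < \<sigma>" "\<sigma> < 1"
  obtains C r where "C > 0" "\<sigma> \<le> r" "r < 1"
    "\<And>x0 v0 \<alpha> b d k i j.
      \<lbrakk>b \<ge> 0; d \<ge> 0; \<And>i. i < N \<Longrightarrow> \<bar>x0 i\<bar> \<le> b; \<And>i. i < N \<Longrightarrow> \<bar>v0 i\<bar> \<le> b;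
       \<And>k i. i < N \<Longrightarrow> \<bar>\<alpha> (Suc k) i\<bar> \<le> d * \<sigma> ^ Suc k; i < N; j < N\<rbrakk>
      \<Longrightarrow> \<bar>linx x0 v0 \<alpha> k i - linx x0 v0 \<alpha> k j\<bar> \<le> C * (b + d) * r ^ k
        \<and> \<bar>linv x0 v0 \<alpha> k i\<bar> \<le> C * (b + d) * r ^ k"
proof -
  obtain B r where B: "B > 0" and r: "\<sigma> \<le> r" "r < 1" and decay:
    "\<And>x y a g b \<beta> k i j.
      \<lbrakk>\<And>k. x (Suc k) = (\<lambda>i. pos (x k) (y k) i + a k i);
       \<And>k. y (Suc k) = (\<lambda>i. vel (x k) (y k) i + g k i);
       b \<ge> 0; \<beta> \<ge> 0;
       \<And>i. i < N \<Longrightarrow> \<bar>x 0 i\<bar> \<le> b; \<And>i. i < N \<Longrightarrow> \<bar>y 0 i\<bar> \<le> b;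
       \<And>k i. i < N \<Longrightarrow> \<bar>a k i\<bar> \<le> \<beta> * \<sigma> ^ k; \<And>k i. i < N \<Longrightarrow> \<bar>g k i\<bar> \<le> \<beta> * \<sigma> ^ k;
       i < N; j < N\<rbrakk>
      \<Longrightarrow> \<bar>x k i - x k j\<bar> \<le> B * (b + \<beta>) * r ^ k \<and> \<bar>y k i\<bar> \<le> B * (b + \<beta>) * r ^ k"
    using perturbed_decay[OF \<sigma>] by blast
  \<comment> \<open>Dominates 2 + h, from the initial data and corrections, and (2 + h) / h, from
    undoing the scaling y = h v.\<close>
  define K where "K = (2 + h) * (1 + 1 / h)"
  define C where "C = B * K"
  have K: "2 + h \<le> K" "(2 + h) / h \<le> K" using h by (auto simp: K_def field_simps)
  have C: "C > 0" using B h by (simp add: C_def K_def add_pos_pos)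
  have "\<bar>linx x0 v0 \<alpha> k i - linx x0 v0 \<alpha> k j\<bar> \<le> C * (b + d) * r ^ k
        \<and> \<bar>linv x0 v0 \<alpha> k i\<bar> \<le> C * (b + d) * r ^ k"
    if b: "b \<ge> 0" and d: "d \<ge> 0"
      and x0: "\<And>i. i < N \<Longrightarrow> \<bar>x0 i\<bar> \<le> b" and v0: "\<And>i. i < N \<Longrightarrow> \<bar>v0 i\<bar> \<le> b"
      and \<alpha>: "\<And>k i. i < N \<Longrightarrow> \<bar>\<alpha> (Suc k) i\<bar> \<le> d * \<sigma> ^ Suc k"
      and ij: "i < N" "j < N"
    for x0 v0 \<alpha> b d k i j
  proof -
    \<comment> \<open>One factor \<sigma> < 1 is dropped to match the indexing of
      \<open>perturbed_decay\<close>; both coefficients of the correction are at most 2 in absolute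
      value.\<close>
    have coef: "\<bar>e * \<alpha> (Suc k) i\<bar> \<le> 2 * d * \<sigma> ^ k" if "i < N" "\<bar>e\<bar> \<le> 2" for e k i
    proof -
      have "\<bar>\<alpha> (Suc k) i\<bar> \<le> d * \<sigma> ^ k"
        using \<alpha>[OF that(1), of k] \<sigma> d power_decreasing[of k "Suc k" \<sigma>]
        by (meson less_imp_le mult_left_mono order_trans le_SucI order_refl)
      then have "\<bar>e\<bar> * \<bar>\<alpha> (Suc k) i\<bar> \<le> 2 * (d * \<sigma> ^ k)"
        using that(2) by (intro mult_mono) auto
      then show ?thesis by (simp add: abs_mult)
    qed
    have "\<bar>linx x0 v0 \<alpha> k i - linx x0 v0 \<alpha> k j\<bar> \<le> B * ((1 + h) * b + 2 * d) * r ^ k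
      \<and> \<bar>h * linv x0 v0 \<alpha> k i\<bar> \<le> B * ((1 + h) * b + 2 * d) * r ^ k"
    proof (rule decay)
      show "linx x0 v0 \<alpha> (Suc k) = (\<lambda>i. pos (linx x0 v0 \<alpha> k) (\<lambda>i. h * linv x0 v0 \<alpha> k i) i
        + (stiff / 2 - 1) * \<alpha> (Suc k) i)" for k
        by (rule linx_Suc_pos)
      show "(\<lambda>i. h * linv x0 v0 \<alpha> (Suc k) i) = (\<lambda>i. vel (linx x0 v0 \<alpha> k) (\<lambda>i. h * linv x0 v0 \<alpha> k i) i
        + stiff * \<alpha> (Suc k) i)" for k
        by (rule linv_Suc_vel)
      fix i assume i: "i < N"
      have hb: "0 \<le> h * b" using h b by simp
      show "\<bar>linx x0 v0 \<alpha> 0 i\<bar> \<le> (1 + h) * b"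
        using x0[OF i] hb by (simp add: lin_0 algebra_simps)
      show "\<bar>h * linv x0 v0 \<alpha> 0 i\<bar> \<le> (1 + h) * b"
      proof -
        have "\<bar>h * linv x0 v0 \<alpha> 0 i\<bar> = h * \<bar>v0 i\<bar>" using h by (simp add: lin_0 abs_mult)
        also have "\<dots> \<le> (1 + h) * b" using h v0[OF i] by (intro mult_mono) auto
        finally show ?thesis .
      qed
      show "\<bar>(stiff / 2 - 1) * \<alpha> (Suc k) i\<bar> \<le> 2 * d * \<sigma> ^ k" for k
        using p_pos p_less_q q_less_2 by (intro coef i) auto
      show "\<bar>stiff * \<alpha> (Suc k) i\<bar> \<le> 2 * d * \<sigma> ^ k" for k
        using p_pos p_less_q q_less_2 by (intro coef i) auto
    qed (use b d h ij in auto)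
    moreover have "B * ((1 + h) * b + 2 * d) * r ^ k \<le> B * ((2 + h) * (b + d)) * r ^ k"
    proof (intro mult_right_mono mult_left_mono)
      show "(1 + h) * b + 2 * d \<le> (2 + h) * (b + d)"
        using b d mult_nonneg_nonneg[of h d] h by (simp add: algebra_simps)
    qed (use B r \<sigma> in auto)
    ultimately have le: "\<bar>linx x0 v0 \<alpha> k i - linx x0 v0 \<alpha> k j\<bar> \<le> (2 + h) * (B * (b + d) * r ^ k)"
      "h * \<bar>linv x0 v0 \<alpha> k i\<bar> \<le> (2 + h) * (B * (b + d) * r ^ k)"
      using h by (auto simp: abs_mult algebra_simps)
    have nonneg: "0 \<le> B * (b + d) * r ^ k" using B b d r \<sigma> by simp
    have "\<bar>linv x0 v0 \<alpha> k i\<bar> \<le> (2 + h) / h * (B * (b + d) * r ^ k)"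
      using le(2) h by (simp add: field_simps)
    then have "\<bar>linv x0 v0 \<alpha> k i\<bar> \<le> K * (B * (b + d) * r ^ k)"
      "\<bar>linx x0 v0 \<alpha> k i - linx x0 v0 \<alpha> k j\<bar> \<le> K * (B * (b + d) * r ^ k)"
      using le(1) mult_right_mono[OF K(1) nonneg] mult_right_mono[OF K(2) nonneg] by linarith+
    then show ?thesis by (simp add: C_def mult_ac)
  qed
  note decay_lin = this
  show ?thesis by (rule that[OF C r]) (fact decay_lin)
qed

end

section \<open>Feasibility and exponential consensus of the constrained scheme\<close>

text \<open>Existence of a trajectory is part of the conclusion, so the claims about all
  trajectories are not vacuous; the unconstrained trajectory is the witness.\<close>

theorem theorem2:
  fixes N :: nat and E :: "nat \<Rightarrow> nat \<Rightarrow> bool"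
    and w1 w2 w3 \<nu> :: real
    and dmin dmax gmax :: "nat \<Rightarrow> real"
  assumes "N \<ge> 2"
    and "undirected_connected_graph N E"
    and "\<forall>i<N. nbrs N E i \<noteq> {}"
    and "w1 > 0" "w2 > 0" "w3 > 0" "\<nu> > 0"
    and "\<forall>i<N. dmin i < 0 \<and> 0 < dmax i \<and> gmax i > 0"
  shows "\<exists>h0>0. \<forall>h. 0 < h \<and> h < h0 \<longrightarrow>
     (\<exists>\<nu>h>0. \<exists>dh>0. \<forall>d x0 v0 alpha.
        0 < d \<and> d < dh
        \<and> (\<forall>i<N. dmin i \<le> v0 i \<and> v0 i \<le> dmax i)
        \<and> (\<forall>i<N. \<bar>x0 i\<bar> < \<nu>h \<and> \<bar>v0 i\<bar> < \<nu>h)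
        \<and> (\<forall>i<N. \<forall>k\<ge>1. \<bar>alpha k i\<bar> \<le> d * exp (- \<nu> * real k * h))
      \<longrightarrow>
        (\<exists>d0 dd0 u d1 dd1.
            mpc_generated N E w1 w2 w3 h dmin dmax gmax alpha x0 v0 d0 dd0 u d1 dd1) \<and>
        (\<forall>d0 dd0 u d1 dd1.
            mpc_generated N E w1 w2 w3 h dmin dmax gmax alpha x0 v0 d0 dd0 u d1 dd1 \<longrightarrow>
              (\<forall>i<N. \<forall>k\<ge>1. dmin i \<le> dd1 k i \<and> dd1 k i \<le> dmax i \<and> \<bar>u k i\<bar> \<le> gmax i)
            \<and> (\<exists>r M Md. 0 < r \<and> r < 1 \<and> M > 0 \<and> Md > 0 \<and>
                 (\<forall>k\<ge>1. \<forall>i<N. \<forall>j<N.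
                    \<bar>d0 k i - d0 k j\<bar> \<le> M * r ^ k \<and> \<bar>dd0 k i\<bar> \<le> Md * r ^ k))))"
proof -
  have main: "\<exists>\<nu>h>0. \<exists>dh>0. \<forall>d x0 v0 alpha.
        0 < d \<and> d < dh
        \<and> (\<forall>i<N. dmin i \<le> v0 i \<and> v0 i \<le> dmax i)
        \<and> (\<forall>i<N. \<bar>x0 i\<bar> < \<nu>h \<and> \<bar>v0 i\<bar> < \<nu>h)
        \<and> (\<forall>i<N. \<forall>k\<ge>1. \<bar>alpha k i\<bar> \<le> d * exp (- \<nu> * real k * h))
      \<longrightarrow>
        (\<exists>d0 dd0 u d1 dd1.
            mpc_generated N E w1 w2 w3 h dmin dmax gmax alpha x0 v0 d0 dd0 u d1 dd1) \<and>
        (\<forall>d0 dd0 u d1 dd1.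
            mpc_generated N E w1 w2 w3 h dmin dmax gmax alpha x0 v0 d0 dd0 u d1 dd1 \<longrightarrow>
              (\<forall>i<N. \<forall>k\<ge>1. dmin i \<le> dd1 k i \<and> dd1 k i \<le> dmax i \<and> \<bar>u k i\<bar> \<le> gmax i)
            \<and> (\<exists>r M Md. 0 < r \<and> r < 1 \<and> M > 0 \<and> Md > 0 \<and>
                 (\<forall>k\<ge>1. \<forall>i<N. \<forall>j<N.
                    \<bar>d0 k i - d0 k j\<bar> \<le> M * r ^ k \<and> \<bar>dd0 k i\<bar> \<le> Md * r ^ k)))"
    if h: "0 < h" for h
  proof -
    interpret mpc_scheme N E w1 w2 w3 h
      using assms h by unfold_locales auto
    define \<sigma> where "\<sigma> = exp (- \<nu> * h)"
    have \<sigma>: "0 < \<sigma>" "\<sigma> < 1" using assms h by (auto simp: \<sigma>_def)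
    have exp_\<sigma>: "exp (- \<nu> * real k * h) = \<sigma> ^ k" for k
      by (simp add: \<sigma>_def mult_ac flip: exp_of_nat_mult)
    obtain C r where C: "C > 0" and r: "\<sigma> \<le> r" "r < 1" and decay:
      "\<And>x0 v0 \<alpha> b d k i j.
        \<lbrakk>b \<ge> 0; d \<ge> 0; \<And>i. i < N \<Longrightarrow> \<bar>x0 i\<bar> \<le> b; \<And>i. i < N \<Longrightarrow> \<bar>v0 i\<bar> \<le> b;
         \<And>k i. i < N \<Longrightarrow> \<bar>\<alpha> (Suc k) i\<bar> \<le> d * \<sigma> ^ Suc k; i < N; j < N\<rbrakk>
        \<Longrightarrow> \<bar>linx x0 v0 \<alpha> k i - linx x0 v0 \<alpha> k j\<bar> \<le> C * (b + d) * r ^ k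
          \<and> \<bar>linv x0 v0 \<alpha> k i\<bar> \<le> C * (b + d) * r ^ k"
      using lin_decay[OF \<sigma>] by blast
    \<comment> \<open>Velocities of size at most \<open>m i\<close> respect both velocity bounds,
      and two of them differ by at most h \<open>gmax i\<close>, which bounds the input since h u is
      their difference.\<close>
    define m where "m i = min (min (- dmin i) (dmax i)) (gmax i * h / 2)" for i
    define \<mu> where "\<mu> = Min (m ` {..<N})"
    have \<mu>_le: "\<mu> \<le> m i" if "i < N" for i
      unfolding \<mu>_def using that by (intro Min_le) auto
    have "\<mu> \<in> m ` {..<N}"
      unfolding \<mu>_def using \<open>N \<ge> 2\<close> by (intro Min_in) (auto simp: lessThan_empty_iff)
    then have \<mu>: "\<mu> > 0" using assms(8) h by (auto simp: m_def)
    \<comment> \<open>Serves as both thresholds: for d < \<epsilon> the velocity bound C (\<epsilon>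
      + d) stays below \<mu>.\<close>
    define \<epsilon> where "\<epsilon> = \<mu> / (2 * C)"
    have \<epsilon>: "\<epsilon> > 0" using \<mu> C by (simp add: \<epsilon>_def)
    show ?thesis
    proof (rule exI[of _ \<epsilon>], rule conjI[OF \<epsilon>], rule exI[of _ \<epsilon>], rule conjI[OF \<epsilon>],
        intro allI impI conjI; (elim conjE)?)
      fix d x0 v0 alpha
      assume d: "0 < d" "d < \<epsilon>"
        and init: "\<forall>i<N. \<bar>x0 i\<bar> < \<epsilon> \<and> \<bar>v0 i\<bar> < \<epsilon>"
        and alpha: "\<forall>i<N. \<forall>k\<ge>1. \<bar>alpha k i\<bar> \<le> d * exp (- \<nu> * real k * h)"
      let ?x = "linx x0 v0 alpha" and ?v = "linv x0 v0 alpha" and ?u = "linu x0 v0 alpha"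
      define B where "B = C * (\<epsilon> + d)"
      have B: "0 < B" "B \<le> \<mu>" proof -
        have "C * (\<epsilon> + d) \<le> C * (2 * \<epsilon>)" using C d by (intro mult_left_mono) auto
        also have "\<dots> = \<mu>" using C by (simp add: \<epsilon>_def)
        finally show "B \<le> \<mu>" by (simp add: B_def)
        show "0 < B" using C \<epsilon> d by (simp add: B_def)
      qed
      have bound: "\<bar>?x k i - ?x k j\<bar> \<le> B * r ^ k" "\<bar>?v k i\<bar> \<le> B * r ^ k"
        if ij: "i < N" "j < N" for i j k
      proof -
        have "\<bar>alpha (Suc k) i\<bar> \<le> d * \<sigma> ^ Suc k" if "i < N" for k i
          using alpha[rule_format, of i "Suc k"] that by (simp only: exp_\<sigma>)
        then have "\<bar>?x k i - ?x k j\<bar> \<le> C * (\<epsilon> + d) * r ^ k \<and> \<bar>?v k i\<bar> \<le> C * (\<epsilon> + d) * r ^ k"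
          using \<epsilon> d init by (intro decay ij) (auto simp: less_imp_le)
        then show "\<bar>?x k i - ?x k j\<bar> \<le> B * r ^ k" "\<bar>?v k i\<bar> \<le> B * r ^ k"
          by (simp_all add: B_def)
      qed
      have v_le: "\<bar>?v k i\<bar> \<le> m i" if "i < N" for i k
      proof -
        have "r ^ k \<le> 1" using r \<sigma> by (intro power_le_one) auto
        then have "B * r ^ k \<le> B" using B by simp
        then show ?thesis using bound(2)[OF that that, of k] \<mu>_le[OF that] B by linarith
      qed
      have feas: "?u (Suc k) i \<in> mpc_feasible (dmin i) (dmax i) (gmax i) h (?v k i)"
        if "i < N" for i k
      proof -
        have "h * \<bar>?u (Suc k) i\<bar> = \<bar>?v (Suc k) i - ?v k i\<bar>"
          using h by (simp add: linv_Suc abs_mult)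
        also have "\<dots> \<le> \<bar>?v (Suc k) i\<bar> + \<bar>?v k i\<bar>" by (rule abs_triangle_ineq4)
        also have "\<dots> \<le> h * gmax i"
          using v_le[OF that, of k] v_le[OF that, of "Suc k"] by (simp add: m_def mult.commute)
        finally have "\<bar>?u (Suc k) i\<bar> \<le> gmax i" using h by simp
        then show ?thesis
          using v_le[OF that, of k] v_le[OF that, of "Suc k"]
          by (auto simp: mpc_feasible_def m_def linv_Suc[symmetric])
      qed
      show "\<exists>d0 dd0 u d1 dd1.
            mpc_generated N E w1 w2 w3 h dmin dmax gmax alpha x0 v0 d0 dd0 u d1 dd1"
        using lin_generated[OF feas] by blast
      fix d0 dd0 u d1 dd1
      assume gen: "mpc_generated N E w1 w2 w3 h dmin dmax gmax alpha x0 v0 d0 dd0 u d1 dd1"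
      \<comment> \<open>These bounds are read off the constraints of step k, without comparison to
        the unconstrained trajectory.\<close>
      show "dmin i \<le> dd1 k i" "dd1 k i \<le> dmax i" "\<bar>u k i\<bar> \<le> gmax i" if "i < N" "1 \<le> k" for i k
      proof -
        have "u k i \<in> mpc_feasible (dmin i) (dmax i) (gmax i) h (dd0 k i)"
          "dd1 k i = dd0 k i + h * u k i"
          using gen that unfolding mpc_generated_def by blast+
        then show "dmin i \<le> dd1 k i" "dd1 k i \<le> dmax i" "\<bar>u k i\<bar> \<le> gmax i"
          by (auto simp: mpc_feasible_def)
      qed
      \<comment> \<open>The values at step k start from the predictions of step k - 1, hence B / r;
        the corrections of two agents add d r^k each.\<close>
      define M where "M = B / r + 2 * d"
      have r0: "0 < r" using r \<sigma> by linarith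
      have M: "M > 0" using B r0 d by (simp add: M_def add_pos_pos)
      have "\<bar>d0 k i - d0 k j\<bar> \<le> M * r ^ k \<and> \<bar>dd0 k i\<bar> \<le> M * r ^ k"
        if k: "1 \<le> k" and ij: "i < N" "j < N" for k i j
      proof -
        have eq: "d0 k i' = ?x (k - 1) i' - alpha k i'" "dd0 k i' = ?v (k - 1) i'" if "i' < N" for i'
          using gen generated_eq_lin[OF feas gen that, of "k - 1"] k that
          by (auto simp: mpc_generated_def)
        have al: "\<bar>alpha k i'\<bar> \<le> d * r ^ k" if "i' < N" for i'
        proof -
          have "\<bar>alpha k i'\<bar> \<le> d * \<sigma> ^ k"
            using alpha k that by (simp only: exp_\<sigma>)
          also have "\<dots> \<le> d * r ^ k"
            using d r \<sigma> by (intro mult_left_mono power_mono) auto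
          finally show ?thesis .
        qed
        have "r ^ k = r * r ^ (k - 1)" using k by (cases k) auto
        then have Mr: "M * r ^ k = B * r ^ (k - 1) + 2 * (d * r ^ k)"
          using r0 by (simp add: M_def algebra_simps)
        have "0 \<le> d * r ^ k" using d r0 by simp
        then show ?thesis
          using bound[OF ij, of "k - 1"] al[OF ij(1)] al[OF ij(2)]
          unfolding eq[OF ij(1)] eq[OF ij(2)] Mr by linarith
      qed
      then show "\<exists>r M Md. 0 < r \<and> r < 1 \<and> M > 0 \<and> Md > 0 \<and>
                 (\<forall>k\<ge>1. \<forall>i<N. \<forall>j<N.
                    \<bar>d0 k i - d0 k j\<bar> \<le> M * r ^ k \<and> \<bar>dd0 k i\<bar> \<le> Md * r ^ k)"
        using M r r0 by blast
    qed
  qed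
  \<comment> \<open>The argument works for every h > 0, so the threshold 1 is arbitrary.\<close>
  show ?thesis by (rule exI[of _ 1]) (use main in simp)
qed

end
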